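(* Let $\Gamma$ be a finite abelian group and let $S\subseteq\Gamma$ with $0\notin S$. Then the spectrum (multiset of eigenvalues of the Hermitian adjacency matrix) of the mixed Cayley graph $Cay(\Gamma,S)$ is $\{\gamma_\alpha:\alpha\in\Gamma\}$, where $\gamma_\alpha=\lambda_\alpha+\mu_\alpha$ and $$\lambda_\alpha=\sum_{s\in S\setminus\overline{S}}\psi_\alpha(s),\qquad \mu_\alpha=i\sum_{s\in\overline{S}}\bigl(\psi_\alpha(s)-\psi_\alpha(-s)\bigr).$$
   Context: $\Gamma$ is identified with $\mathbb{Z}_{n_1}\times\cdots\times\mathbb{Z}_{n_k}$, each $n_j$ a prime power. For $\alpha=(\alpha_1,\dots,\alpha_k)$ and $x=(x_1,\dots,x_k)$ in $\Gamma$, the character $\psi_\alpha$ is $\psi_\alpha(x)=\prod_{j=1}^k w_{n_j}^{\alpha_jx_j}$ with $w_{n_j}=\exp(2\pi i/n_j)$; $i=\sqrt{-1}$. For $S\subseteq\Gamma$ with $0\notin S$, put $\overline{S}=\{u\in S:-u\notin S\}$. The mixed Cayley graph $Cay(\Gamma,S)$ has vertex set $\Gamma$ and edge set $E=\{(a,b)\in\Gamma\times\Gamma: b-a\in S\}$. Its Hermitian adjacency matrix $H=(h_{uv})_{u,v\in\Gamma}$ has $h_{uv}=1$ if $(u,v)\in E$ and $(v,u)\in E$; $h_{uv}=i$ if $(u,v)\in E$ and $(v,u)\notin E$; $h_{uv}=-i$ if $(u,v)\notin E$ and $(v,u)\in E$; and $h_{uv}=0$ otherwise. *)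

theory Defs
  imports
    "HOL-Algebra.Elementary_Groups"
    "HOL-Algebra.Product_Groups"
    "HOL-Number_Theory.Prime_Powers"
    "Jordan_Normal_Form.Spectral_Radius"
    "Graph_Theory.Pair_Digraph"
begin

text \<open>
  Abelian groups are HOL-Algebra groups, hence written multiplicatively: \<open>\<one>\<close> is the additive
  \<open>0\<close>, \<open>inv a\<close> is \<open>-a\<close>, and \<open>b \<otimes> inv a\<close> is \<open>b - a\<close>.
\<close>

text \<open>\<open>\<int>\<^sub>n\<^sub>1 \<times> \<dots> \<times> \<int>\<^sub>n\<^sub>k\<close>; coordinates are the representatives in \<open>{0..<n j}\<close>, and
  elements are undefined outside \<open>{1..k}\<close>.\<close>

definition cyclic_product :: "nat \<Rightarrow> (nat \<Rightarrow> nat) \<Rightarrow> (nat \<Rightarrow> int) monoid" where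
  "cyclic_product k n = product_group {1..k} (\<lambda>j. integer_mod_group (n j))"

definition root_unity :: "nat \<Rightarrow> complex" where
  "root_unity m = exp (2 * of_real pi * \<i> / of_nat m)"

text \<open>\<open>\<phi>\<close> sends an element of the group to its coordinate vector in \<open>cyclic_product k n\<close>.\<close>

definition character ::
  "nat \<Rightarrow> (nat \<Rightarrow> nat) \<Rightarrow> ('a \<Rightarrow> nat \<Rightarrow> int) \<Rightarrow> 'a \<Rightarrow> 'a \<Rightarrow> complex" where
  "character k n \<phi> \<alpha> x = (\<Prod>j = 1..k. root_unity (n j) powi (\<phi> \<alpha> j * \<phi> x j))"

definition one_way :: "('a, 'b) monoid_scheme \<Rightarrow> 'a set \<Rightarrow> 'a set" where
  "one_way G S = {u \<in> S. inv\<^bsub>G\<^esub> u \<notin> S}"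

definition Cay :: "('a, 'b) monoid_scheme \<Rightarrow> 'a set \<Rightarrow> 'a pair_pre_digraph" where
  "Cay G S = \<lparr> pverts = carrier G,
     parcs = {(a, b). a \<in> carrier G \<and> b \<in> carrier G \<and> b \<otimes>\<^bsub>G\<^esub> inv\<^bsub>G\<^esub> a \<in> S} \<rparr>"

definition hermitian_entry :: "'a pair_pre_digraph \<Rightarrow> 'a \<Rightarrow> 'a \<Rightarrow> complex" where
  "hermitian_entry D u v =
     (if (u, v) \<in> parcs D \<and> (v, u) \<in> parcs D then 1
      else if (u, v) \<in> parcs D \<and> (v, u) \<notin> parcs D then \<i>
      else if (u, v) \<notin> parcs D \<and> (v, u) \<in> parcs D then - \<i>
      else 0)"

text \<open>\<open>vs\<close> is meant to list every vertex exactly once; it fixes the order of rows and columns.\<close>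

definition hermitian_adjacency_mat :: "'a pair_pre_digraph \<Rightarrow> 'a list \<Rightarrow> complex mat" where
  "hermitian_adjacency_mat D vs =
     mat (length vs) (length vs) (\<lambda>(i, j). hermitian_entry D (vs ! i) (vs ! j))"

text \<open>The eigenvalues, each with its algebraic multiplicity.\<close>

definition spectrum_mset :: "complex mat \<Rightarrow> complex multiset" where
  "spectrum_mset A =
     (\<Sum>e \<in> spectrum A. replicate_mset (Polynomial.order e (char_poly A)) e)"

lemma spectrum_mset_eq_proots:
  assumes A: "A \<in> carrier_mat m m"
  shows "spectrum_mset A = proots (char_poly A)"
proof (rule multiset_eqI)
  fix x
  have nz: "char_poly A \<noteq> 0"
    using degree_monic_char_poly[OF A] by auto
  have fin: "finite (spectrum A)"
    using card_finite_spectrum(1)[OF A] .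
  have "count (spectrum_mset A) x
      = (\<Sum>e \<in> spectrum A. if x = e then Polynomial.order e (char_poly A) else 0)"
    by (auto simp: spectrum_mset_def count_sum intro!: sum.cong)
  also have "\<dots> = (if x \<in> spectrum A then Polynomial.order x (char_poly A) else 0)"
    using fin by simp
  also have "\<dots> = Polynomial.order x (char_poly A)"
    using nz by (simp add: spectrum_root_char_poly[OF A] Polynomial.order_root)
  finally show "count (spectrum_mset A) x = count (proots (char_poly A)) x"
    using nz by simp
qed

end

theory Submission
  imports Defs
begin

text \<open>
  The entry of the Hermitian adjacency matrix at \<open>(u, v)\<close> depends only on \<open>v - u\<close>, so the matrix
  is the matrix of a convolution on the group and every character is an eigenvector. Explicitly, if
  the entry is \<open>f (v - u)\<close>, then \<open>\<Sum>\<^sub>v f (v - u) \<psi> v = (\<Sum>\<^sub>d f d * \<psi> d) * \<psi> u\<close>, by the substitution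
  \<open>d = v - u\<close>. The characters are pairwise orthogonal and there are as many of them as vertices, so
  they form an eigenbasis and the sums \<open>\<Sum>\<^sub>d f d * \<psi> d\<close> are all the eigenvalues with their
  multiplicities (\<open>proots_char_poly_group_mat\<close>). For the function \<open>f\<close> of a mixed Cayley graph this
  sum is \<open>\<gamma>\<^sub>\<alpha>\<close>: an undirected \<open>s\<close> contributes \<open>\<psi> s\<close>, while a one-way \<open>s\<close> is met twice,
  once at \<open>d = s\<close> with weight \<open>\<i>\<close> and once at \<open>d = -s\<close> with weight \<open>-\<i>\<close>.

  The argument rests on three properties of the explicit characters: they are multiplicative,
  \<open>\<psi>\<^sub>\<alpha> x = \<psi>\<^sub>x \<alpha>\<close>, and each \<open>x\<close> other than the neutral element is separated from it by some
  \<open>\<psi>\<^sub>\<alpha>\<close>. By the symmetry, the orthogonality relation may be summed over either argument, and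
  separation yields it directly.
\<close>

section \<open>Diagonalised matrices\<close>

lemma proots_prod_list_linear:
  "proots (\<Prod>a\<leftarrow>ds. [:- a, 1:]) = mset (ds :: 'a :: idom list)"
proof -
  have "proots (\<Prod>p\<leftarrow>map (\<lambda>a. [:- a, 1:]) ds. p) = (\<Sum>p\<leftarrow>map (\<lambda>a. [:- a, 1:]) ds. proots p)"
    by (rule proots_prod_list) auto
  also have "\<dots> = mset ds"
    by (induction ds) auto
  finally show ?thesis by simp
qed

text \<open>
  The columns of \<open>P\<close> form a basis of eigenvectors, so \<open>A\<close> is similar to the diagonal matrix of the
  \<open>d i\<close>.
\<close>

lemma proots_char_poly_eigenbasis:
  fixes A P Q :: "'a :: field mat"
  assumes A: "A \<in> carrier_mat m m" and P: "P \<in> carrier_mat m m" and Q: "Q \<in> carrier_mat m m"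
    and PQ: "P * Q = 1\<^sub>m m"
    and AP: "A * P = P * mat m m (\<lambda>(i, j). if i = j then d i else 0)"
  shows "proots (char_poly A) = image_mset d (mset [0..<m])"
proof -
  define D where "D = mat m m (\<lambda>(i, j). if i = j then d i else 0)"
  have D: "D \<in> carrier_mat m m"
    by (simp add: D_def)
  have "A = A * (P * Q)"
    using A PQ by simp
  also have "\<dots> = P * D * Q"
    using A P Q AP by (simp add: assoc_mult_mat[symmetric] D_def)
  finally have "similar_mat_wit A D P Q"
    using PQ mat_mult_left_right_inverse[OF P Q PQ] A D P Q by (intro similar_mat_witI)
  then have "char_poly A = char_poly D"
    by (intro char_poly_similar) (auto simp: similar_mat_def)
  also have "\<dots> = (\<Prod>a\<leftarrow>diag_mat D. [:- a, 1:])"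
    by (rule char_poly_upper_triangular[OF D]) (auto simp: D_def)
  also have "diag_mat D = map d [0..<m]"
    by (auto simp: diag_mat_def D_def)
  finally show ?thesis
    by (simp only: proots_prod_list_linear mset_map)
qed

section \<open>Convolution matrices on a finite abelian group\<close>

text \<open>
  A symmetric nondegenerate pairing into the multiplicative group of a field indexes characters of
  the group by its own elements: \<open>\<chi> \<alpha>\<close> is the character belonging to \<open>\<alpha>\<close>.
\<close>

locale self_pairing = comm_group G for G (structure) +
  fixes \<chi> :: "'a \<Rightarrow> 'a \<Rightarrow> 'c :: field_char_0"
  assumes fin: "finite (carrier G)"
    and pairing_mult: "\<lbrakk>\<alpha> \<in> carrier G; x \<in> carrier G; y \<in> carrier G\<rbrakk> \<Longrightarrow> \<chi> \<alpha> (x \<otimes> y) = \<chi> \<alpha> x * \<chi> \<alpha> y"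
    and pairing_one: "\<alpha> \<in> carrier G \<Longrightarrow> \<chi> \<alpha> \<one> = 1"
    and pairing_sym: "\<chi> \<alpha> x = \<chi> x \<alpha>"
    and nondegenerate: "\<lbrakk>x \<in> carrier G; x \<noteq> \<one>\<rbrakk> \<Longrightarrow> \<exists>\<alpha> \<in> carrier G. \<chi> x \<alpha> \<noteq> 1"
begin

lemma sum_translate:
  assumes "a \<in> carrier G"
  shows "(\<Sum>x\<in>carrier G. g (x \<otimes> a)) = (\<Sum>x\<in>carrier G. g x)"
proof (rule sum.reindex_bij_witness[where i = "\<lambda>x. x \<otimes> inv a" and j = "\<lambda>x. x \<otimes> a"])
  fix x assume "x \<in> carrier G"
  then show "x \<otimes> a \<otimes> inv a = x" "x \<otimes> inv a \<otimes> a = x"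
    using assms by (simp_all add: m_assoc)
qed (use assms in auto)

text \<open>
  Translating the summation variable by an element at which \<open>\<chi> z\<close> differs from \<open>1\<close> multiplies the
  sum by that value, so the sum vanishes.
\<close>

lemma sum_pairing:
  assumes z: "z \<in> carrier G"
  shows "(\<Sum>\<alpha>\<in>carrier G. \<chi> \<alpha> z) = (if z = \<one> then of_nat (card (carrier G)) else 0)"
proof (cases "z = \<one>")
  case True
  then show ?thesis by (simp add: pairing_one)
next
  case False
  then obtain b where b: "b \<in> carrier G" "\<chi> z b \<noteq> 1"
    using z nondegenerate by blast
  have "(\<Sum>\<alpha>\<in>carrier G. \<chi> z \<alpha>) = (\<Sum>\<alpha>\<in>carrier G. \<chi> z (\<alpha> \<otimes> b))"
    by (rule sum_translate[OF b(1), symmetric])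
  also have "\<dots> = (\<Sum>\<alpha>\<in>carrier G. \<chi> z \<alpha>) * \<chi> z b"
    using z b by (simp add: pairing_mult sum_distrib_right)
  finally have "(\<Sum>\<alpha>\<in>carrier G. \<chi> z \<alpha>) * (1 - \<chi> z b) = 0"
    by (simp add: algebra_simps)
  then show ?thesis
    using b False by (simp add: pairing_sym[of _ z])
qed

lemma sum_convolution:
  assumes "\<alpha> \<in> carrier G" and u: "u \<in> carrier G"
  shows "(\<Sum>v\<in>carrier G. f (v \<otimes> inv u) * \<chi> \<alpha> v) = (\<Sum>d\<in>carrier G. f d * \<chi> \<alpha> d) * \<chi> \<alpha> u"
proof -
  have "(\<Sum>v\<in>carrier G. f (v \<otimes> inv u) * \<chi> \<alpha> v)
      = (\<Sum>d\<in>carrier G. f (d \<otimes> u \<otimes> inv u) * \<chi> \<alpha> (d \<otimes> u))"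
    by (rule sum_translate[OF u, symmetric])
  also have "\<dots> = (\<Sum>d\<in>carrier G. f d * \<chi> \<alpha> d * \<chi> \<alpha> u)"
    using assms by (intro sum.cong) (simp_all add: m_assoc pairing_mult)
  finally show ?thesis
    by (simp add: sum_distrib_right)
qed

theorem proots_char_poly_group_mat:
  assumes vs: "distinct vs" "set vs = carrier G"
  shows "proots (char_poly (mat (length vs) (length vs) (\<lambda>(i, j). f (vs ! j \<otimes> inv (vs ! i)))))
       = {# \<Sum>d\<in>carrier G. f d * \<chi> \<alpha> d . \<alpha> \<in># mset_set (carrier G) #}"
proof -
  let ?m = "length vs"
  define ev where "ev \<alpha> = (\<Sum>d\<in>carrier G. f d * \<chi> \<alpha> d)" for \<alpha>
  define A where "A = mat ?m ?m (\<lambda>(i, j). f (vs ! j \<otimes> inv (vs ! i)))"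
  define P where "P = mat ?m ?m (\<lambda>(i, j). \<chi> (vs ! j) (vs ! i))"
  (* The pairing with the inverse plays the role of the complex conjugate, so Q is the inverse of P. *)
  define Q where "Q = mat ?m ?m (\<lambda>(i, j). \<chi> (vs ! i) (inv (vs ! j)) / of_nat ?m)"
  have mem: "vs ! i \<in> carrier G" if "i < ?m" for i
    using nth_mem[OF that] vs(2) by blast
  have card: "card (carrier G) = ?m"
    using distinct_card[OF vs(1)] vs(2) by simp
  have sum_vs: "(\<Sum>i = 0..<?m. g (vs ! i)) = (\<Sum>x\<in>carrier G. g x)" for g :: "'a \<Rightarrow> 'c"
    using sum.reindex_bij_betw[OF bij_betw_nth[OF vs(1), of "{0..<?m}" "carrier G"], of g] vs
    by (simp add: atLeast0LessThan)
  have "P * Q = 1\<^sub>m ?m"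
  proof (rule eq_matI)
    fix i j assume "i < dim_row (1\<^sub>m ?m)" "j < dim_col (1\<^sub>m ?m)"
    then have ij: "i < ?m" "j < ?m" by simp_all
    have "(P * Q) $$ (i, j)
        = (\<Sum>l = 0..<?m. \<chi> (vs ! l) (vs ! i) * \<chi> (vs ! l) (inv (vs ! j)) / of_nat ?m)"
      using ij by (simp add: P_def Q_def scalar_prod_def)
    also have "\<dots> = (\<Sum>\<alpha>\<in>carrier G. \<chi> \<alpha> (vs ! i) * \<chi> \<alpha> (inv (vs ! j)) / of_nat ?m)"
      by (rule sum_vs)
    also have "\<dots> = (\<Sum>\<alpha>\<in>carrier G. \<chi> \<alpha> (vs ! i \<otimes> inv (vs ! j))) / of_nat ?m"
      using ij by (simp add: pairing_mult mem sum_divide_distrib)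
    also have "\<dots> = (if i = j then 1 else 0)"
    proof -
      have "vs ! i \<otimes> inv (vs ! j) = \<one> \<longleftrightarrow> vs ! i = vs ! j"
        using ij mem by (metis inv_closed inv_equality inv_inv r_inv)
      then have "vs ! i \<otimes> inv (vs ! j) = \<one> \<longleftrightarrow> i = j"
        using nth_eq_iff_index_eq[OF vs(1) ij] by blast
      moreover have "?m \<noteq> 0" using ij by linarith
      ultimately show ?thesis
        using ij by (simp add: sum_pairing mem card)
    qed
    finally show "(P * Q) $$ (i, j) = 1\<^sub>m ?m $$ (i, j)"
      using ij by simp
  qed (simp_all add: P_def Q_def)
  moreover have "A * P = P * mat ?m ?m (\<lambda>(i, j). if i = j then ev (vs ! i) else 0)"
  proof (rule eq_matI; simp add: A_def P_def scalar_prod_def)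
    fix i j assume ij: "i < ?m" "j < ?m"
    have "(\<Sum>l = 0..<?m. f (vs ! l \<otimes> inv (vs ! i)) * \<chi> (vs ! j) (vs ! l))
        = (\<Sum>v\<in>carrier G. f (v \<otimes> inv (vs ! i)) * \<chi> (vs ! j) v)"
      by (rule sum_vs)
    also have "\<dots> = ev (vs ! j) * \<chi> (vs ! j) (vs ! i)"
      unfolding ev_def using ij by (intro sum_convolution mem)
    also have "\<dots> = (\<Sum>l = 0..<?m. \<chi> (vs ! l) (vs ! i) * (if l = j then ev (vs ! l) else 0))"
      using ij by (simp add: if_distrib cong: if_cong)
    finally show "(\<Sum>l = 0..<?m. f (vs ! l \<otimes> inv (vs ! i)) * \<chi> (vs ! j) (vs ! l))
        = (\<Sum>l = 0..<?m. \<chi> (vs ! l) (vs ! i) * (if l = j then ev (vs ! l) else 0))" .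
  qed
  ultimately have "proots (char_poly A) = image_mset (\<lambda>i. ev (vs ! i)) (mset [0..<?m])"
    by (intro proots_char_poly_eigenbasis) (simp_all add: A_def P_def Q_def)
  also have "\<dots> = image_mset ev (mset (map ((!) vs) [0..<?m]))"
    by (simp add: multiset.map_comp comp_def)
  also have "\<dots> = image_mset ev (mset_set (carrier G))"
    using vs by (simp add: map_nth mset_set_set[symmetric])
  finally show ?thesis
    unfolding A_def ev_def .
qed

end

section \<open>The characters of a product of cyclic groups\<close>

lemma root_unity_powi_eq_1_iff:
  assumes "m > 0"
  shows "root_unity m powi x = 1 \<longleftrightarrow> int m dvd x"
proof -
  have "root_unity m powi x = cis (2 * pi * x / m)"
    by (simp add: root_unity_def exp_power_int cis_conv_exp algebra_simps)
  also have "\<dots> = 1 \<longleftrightarrow> cos (2 * pi * x / m) = 1"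
    by (auto simp: complex_eq_iff cos_one_sin_zero)
  also have "\<dots> \<longleftrightarrow> (\<exists>l::int. 2 * pi * x / m = 2 * l * pi)"
    by (simp add: cos_one_2pi_int mult_ac)
  also have "\<dots> \<longleftrightarrow> (\<exists>l::int. x = int m * l)"
  proof -
    have "2 * pi * x / m = 2 * l * pi \<longleftrightarrow> x = int m * l" for l :: int
    proof -
      have "2 * pi * x / m = 2 * l * pi \<longleftrightarrow> real_of_int x = real_of_int (int m * l)"
        using assms by (simp add: field_simps)
      then show ?thesis by (simp only: of_int_eq_iff)
    qed
    then show ?thesis by simp
  qed
  finally show ?thesis by (simp add: dvd_def)
qed

lemma root_unity_nonzero [simp]: "root_unity m \<noteq> 0"
  by (simp add: root_unity_def)

lemma root_unity_powi_mult_mod: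
  "root_unity m powi (a * (c mod int m)) = root_unity m powi (a * c)"
proof (cases "m = 0")
  case False
  have "a * c = a * (c mod int m) + int m * (a * (c div int m))"
    by (metis distrib_left mult.left_commute mod_mult_div_eq)
  moreover have "root_unity m powi (int m * (a * (c div int m))) = 1"
    using False by (simp add: root_unity_powi_eq_1_iff)
  ultimately show ?thesis
    by (simp add: power_int_add)
qed simp

lemma self_pairing_character:
  fixes G :: "('a, 'b) monoid_scheme"
  assumes G: "comm_group G" "finite (carrier G)"
    and n: "\<And>j. j \<in> {1..k} \<Longrightarrow> n j > 0"
    and \<phi>: "\<phi> \<in> iso G (cyclic_product k n)"
  shows "self_pairing G (character k n \<phi>)"
proof -
  interpret comm_group G by fact
  interpret C: group "cyclic_product k n"
    unfolding cyclic_product_def by (rule product_group) simp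
  interpret group_hom G "cyclic_product k n" \<phi>
    using \<phi> by unfold_locales (simp add: iso_def)
  have bij: "bij_betw \<phi> (carrier G) (carrier (cyclic_product k n))"
    using \<phi> by (simp add: iso_def)
  have one_G: "\<one>\<^bsub>G\<^esub> \<in> carrier G"
    by simp
  have one: "\<phi> \<one>\<^bsub>G\<^esub> j = 0" if "j \<in> {1..k}" for j
    using hom_one that by (simp add: cyclic_product_def)
  have mult: "\<phi> (x \<otimes>\<^bsub>G\<^esub> y) j = (\<phi> x j + \<phi> y j) mod int (n j)"
    if "x \<in> carrier G" "y \<in> carrier G" "j \<in> {1..k}" for x y j
    using hom_mult[OF that(1,2)] that(3) by (simp add: cyclic_product_def)
  have range: "\<phi> x \<in> (\<Pi>\<^sub>E j\<in>{1..k}. {0..<int (n j)})" if "x \<in> carrier G" for x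
  proof -
    have "(\<Pi>\<^sub>E j\<in>{1..k}. carrier (integer_mod_group (n j))) = (\<Pi>\<^sub>E j\<in>{1..k}. {0..<int (n j)})"
      using n by (intro PiE_cong) (auto simp: carrier_integer_mod_group)
    then show ?thesis
      using hom_closed[OF that] by (simp add: cyclic_product_def)
  qed
  show ?thesis
  proof
    fix \<alpha> x y assume "\<alpha> \<in> carrier G" "x \<in> carrier G" "y \<in> carrier G"
    then show "character k n \<phi> \<alpha> (x \<otimes>\<^bsub>G\<^esub> y) = character k n \<phi> \<alpha> x * character k n \<phi> \<alpha> y"
      unfolding character_def prod.distrib[symmetric]
      by (intro prod.cong refl)
        (simp add: mult root_unity_powi_mult_mod distrib_left power_int_add del: hom_mult)
  next
    fix \<alpha> show "character k n \<phi> \<alpha> \<one>\<^bsub>G\<^esub> = 1"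
      by (simp add: character_def one del: hom_one)
  next
    fix \<alpha> x show "character k n \<phi> \<alpha> x = character k n \<phi> x \<alpha>"
      by (simp add: character_def mult.commute)
  next
    fix x assume x: "x \<in> carrier G" "x \<noteq> \<one>\<^bsub>G\<^esub>"
    have "\<exists>j\<in>{1..k}. \<phi> x j \<noteq> 0"
    proof (rule ccontr)
      assume "\<not> ?thesis"
      then have "\<phi> x = \<phi> \<one>\<^bsub>G\<^esub>"
        using one by (intro PiE_ext[OF range range] x one_G) simp
      then show False
        using x inj_onD[OF bij_betw_imp_inj_on[OF bij] _ x(1) one_G] by blast
    qed
    then obtain j where j: "j \<in> {1..k}" "\<phi> x j \<noteq> 0" by blast
    then have xj: "0 < \<phi> x j" "\<phi> x j < int (n j)"
      using PiE_mem[OF range[OF x(1)] j(1)] by simp_all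
    (* Pairing x with the j-th unit vector isolates its j-th coordinate. *)
    define e where "e = (\<lambda>i\<in>{1..k}. if i = j then 1 else 0 :: int)"
    have "e \<in> carrier (cyclic_product k n)"
      using n xj by (auto simp: e_def cyclic_product_def carrier_integer_mod_group)
    then obtain \<beta> where \<beta>: "\<beta> \<in> carrier G" "\<phi> \<beta> = e"
      using bij_betw_imp_surj_on[OF bij] by (metis imageE)
    have "character k n \<phi> x \<beta> = (\<Prod>i = 1..k. if i = j then root_unity (n j) powi \<phi> x j else 1)"
      unfolding character_def \<beta> by (intro prod.cong) (auto simp: e_def)
    also have "\<dots> = root_unity (n j) powi \<phi> x j"
      using j by simp
    also have "\<dots> \<noteq> 1"
      using root_unity_powi_eq_1_iff[OF n[OF j(1)]] zdvd_not_zless[OF xj] by simp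
    finally show "\<exists>\<alpha>\<in>carrier G. character k n \<phi> x \<alpha> \<noteq> 1"
      using \<beta> by blast
  qed (use G in simp)
qed

section \<open>The Hermitian adjacency matrix of a mixed Cayley graph\<close>

text \<open>
  The entry at \<open>(u, v)\<close> as a function of \<open>v - u\<close>. Writing it as a combination of indicators,
  rather than by cases, lets a weighted sum over the group split into sums over the parts of \<open>S\<close>.
\<close>

definition connection_weight :: "('a, 'b) monoid_scheme \<Rightarrow> 'a set \<Rightarrow> 'a \<Rightarrow> complex" where
  "connection_weight G S d =
     of_bool (d \<in> S - one_way G S)
     + \<i> * (of_bool (d \<in> one_way G S) - of_bool (inv\<^bsub>G\<^esub> d \<in> one_way G S))"

context comm_group
begin

lemma hermitian_entry_Cay:
  assumes u: "u \<in> carrier G" and v: "v \<in> carrier G"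
  shows "hermitian_entry (Cay G S) u v = connection_weight G S (v \<otimes> inv u)"
proof -
  have "inv (v \<otimes> inv u) = u \<otimes> inv v"
    using u v by (simp add: inv_mult m_comm)
  moreover have "inv (u \<otimes> inv v) = v \<otimes> inv u"
    using u v by (simp add: inv_mult m_comm)
  ultimately show ?thesis
    using u v by (simp add: hermitian_entry_def connection_weight_def Cay_def one_way_def)
qed

lemma sum_connection_weight:
  assumes fin: "finite (carrier G)" and S: "S \<subseteq> carrier G"
  shows "(\<Sum>d\<in>carrier G. connection_weight G S d * g d)
       = (\<Sum>s\<in>S - one_way G S. g s) + \<i> * (\<Sum>s\<in>one_way G S. g s - g (inv s))"
proof -
  have sub: "one_way G S \<subseteq> carrier G"
    using S by (auto simp: one_way_def)
  have restrict: "(\<Sum>d\<in>carrier G. of_bool (d \<in> T) * h d) = (\<Sum>d\<in>T. h d)"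
    if "T \<subseteq> carrier G" for T and h :: "'a \<Rightarrow> complex"
    using fin that by (simp add: of_bool_def if_distrib[of "\<lambda>c. c * _"] sum.If_cases Int_absorb1
        cong: if_cong)
  have "(\<Sum>d\<in>carrier G. of_bool (inv d \<in> one_way G S) * g d)
      = (\<Sum>d\<in>carrier G. of_bool (d \<in> one_way G S) * g (inv d))"
    by (rule sum.reindex_bij_witness[where i = "\<lambda>d. inv d" and j = "\<lambda>d. inv d"]) auto
  then show ?thesis
    using restrict[of "S - one_way G S" g] restrict[OF sub, of g]
      restrict[OF sub, of "\<lambda>d. g (inv d)"] S
    by (simp add: connection_weight_def ring_distribs sum.distrib sum_subtractf mult.assoc
        Diff_subset[THEN subset_trans] flip: sum_distrib_left)
qed

end

theorem lemma2p5:
  fixes G :: "('a, 'b) monoid_scheme"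
    and k :: nat and n :: "nat \<Rightarrow> nat"
    and \<phi> :: "'a \<Rightarrow> nat \<Rightarrow> int"
    and S :: "'a set" and vs :: "'a list"
  assumes "comm_group G" and "finite (carrier G)"
    and "\<And>j. j \<in> {1..k} \<Longrightarrow> primepow (n j)"
    and "\<phi> \<in> iso G (cyclic_product k n)"
    and "S \<subseteq> carrier G" and "\<one>\<^bsub>G\<^esub> \<notin> S"
    and "distinct vs" and "set vs = pverts (Cay G S)"
  shows "spectrum_mset (hermitian_adjacency_mat (Cay G S) vs) =
    {# (\<Sum>s \<in> S - one_way G S. character k n \<phi> \<alpha> s)
       + \<i> * (\<Sum>s \<in> one_way G S. character k n \<phi> \<alpha> s - character k n \<phi> \<alpha> (inv\<^bsub>G\<^esub> s))
       . \<alpha> \<in># mset_set (carrier G) #}"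
proof -
  interpret self_pairing G "character k n \<phi>"
    using assms by (intro self_pairing_character primepow_gt_0_nat)
  have vs: "set vs = carrier G"
    using assms(8) by (simp add: Cay_def)
  have H: "hermitian_adjacency_mat (Cay G S) vs = mat (length vs) (length vs)
      (\<lambda>(i, j). connection_weight G S (vs ! j \<otimes>\<^bsub>G\<^esub> inv\<^bsub>G\<^esub> (vs ! i)))"
    unfolding hermitian_adjacency_mat_def
  proof (rule cong_mat)
    fix i j assume "i < length vs" "j < length vs"
    then have "vs ! i \<in> carrier G" "vs ! j \<in> carrier G"
      using vs nth_mem by blast+
    then show "(case (i, j) of (i, j) \<Rightarrow> hermitian_entry (Cay G S) (vs ! i) (vs ! j))
        = (case (i, j) of (i, j) \<Rightarrow> connection_weight G S (vs ! j \<otimes>\<^bsub>G\<^esub> inv\<^bsub>G\<^esub> (vs ! i)))"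
      by (simp only: prod.case hermitian_entry_Cay)
  qed simp_all
  have "spectrum_mset (hermitian_adjacency_mat (Cay G S) vs)
      = proots (char_poly (hermitian_adjacency_mat (Cay G S) vs))"
    by (rule spectrum_mset_eq_proots[of _ "length vs"]) (simp add: hermitian_adjacency_mat_def)
  also have "\<dots> = {# \<Sum>d\<in>carrier G. connection_weight G S d * character k n \<phi> \<alpha> d
      . \<alpha> \<in># mset_set (carrier G) #}"
    unfolding H by (rule proots_char_poly_group_mat[OF assms(7) vs])
  finally show ?thesis
    by (simp only: sum_connection_weight[OF assms(2,5)])
qed

end
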